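(* Let $(V_1,V_2)$ have uniform marginals on $[0,1]$, and probability density function $c$. Let $(U_1,U_2)$ also have uniform marginals on $[0,1]$, and let $U_1$ be independent of $U_2$. Then $$d_{\mathcal{W}}\left[(V_1,V_2),(U_1,U_2)\right]\le\frac{2}{\pi^2}\sqrt{\int_{[0,1]^2}|\nabla c(x_1,x_2)|^2\,dx_1\,dx_2}.$$
   Context: $|\cdot|$ is the Euclidean norm. The 1-Wasserstein distance between random vectors $X,Y$ in $\mathbb{R}^2$ is $d_{\mathcal{W}}(X,Y)=\sup_h|\mathbb{E}[h(X)]-\mathbb{E}[h(Y)]|$, the supremum being over all Lipschitz $h:\mathbb{R}^2\to\mathbb{R}$ with Lipschitz constant at most $1$. The density is $c=\partial^2_{x_1x_2}C$, where $C(x_1,x_2)=\mathbb{P}[V_1\le x_1,V_2\le x_2]$, $(x_1,x_2)\in[0,1]^2$, is the copula of $(V_1,V_2)$. Standing assumption on all densities $p$ considered: with $K_p$ the support of $p$ (the complement of the largest open set on which $p\equiv0$), there is an open set $\Omega_p$ such that $K_p\setminus\Omega_p$ is Lebesgue-null, $p>0$ on $\Omega_p$ and $p$ is $\mathcal{C}^1$ on $\Omega_p$.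
   Formalization: The gradient of c is additionally required to be its distributional gradient on the open unit square; with only the pointwise gradient on Ω_c the claim fails, e.g. for c = 2 on (0,1/2)² ∪ (1/2,1)² and 0 elsewhere. *)

theory Defs
  imports "HOL-Probability.Probability"
begin

text \<open>
  \<open>E[h(X)]\<close> is a Bochner integral, hence 0 when \<open>h(X)\<close> is not integrable. This
  convention is irrelevant for vectors with finite first moment, in particular for almost
  surely bounded ones.
\<close>

definition wasserstein_dist ::
    "'a measure \<Rightarrow> ('a \<Rightarrow> 'c::euclidean_space) \<Rightarrow> 'b measure \<Rightarrow> ('b \<Rightarrow> 'c) \<Rightarrow> ennreal"
  where "wasserstein_dist M X N Y =
    (SUP h \<in> {h :: 'c \<Rightarrow> real. 1-lipschitz_on UNIV h}.
       ennreal \<bar>(\<integral>\<omega>. h (X \<omega>) \<partial>M) - (\<integral>\<omega>. h (Y \<omega>) \<partial>N)\<bar>)"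

definition ennreal_sqrt :: "ennreal \<Rightarrow> ennreal"
  where "ennreal_sqrt t = (if t = \<top> then \<top> else ennreal (sqrt (enn2real t)))"

definition density_support :: "('a::topological_space \<Rightarrow> real) \<Rightarrow> 'a set"
  where "density_support p = - \<Union>{G. open G \<and> (\<forall>x\<in>G. p x = 0)}"

text \<open>
  The standing regularity assumption on densities, for a given \<open>\<Omega>\<close>; \<open>\<nabla>p\<close> on \<open>\<Omega>\<close> is
  passed as the function \<open>grad_p\<close>.
\<close>

definition C1_density ::
    "('a::euclidean_space \<Rightarrow> real) \<Rightarrow> 'a set \<Rightarrow> ('a \<Rightarrow> 'a) \<Rightarrow> bool"
  where "C1_density p \<Omega> grad_p \<longleftrightarrow>
    open \<Omega> \<and> density_support p - \<Omega> \<in> null_sets lborel \<and>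
    (\<forall>x\<in>\<Omega>. 0 < p x) \<and>
    (\<forall>x\<in>\<Omega>. GDERIV p x :> grad_p x) \<and> continuous_on \<Omega> grad_p"

text \<open>
  The function \<open>g\<close> is the gradient of \<open>f\<close> on the open set \<open>S\<close> in the sense of
  distributions (for \<open>f\<close> and \<open>g\<close> locally integrable). It is unique up to null sets, and it
  is the classical gradient if \<open>f\<close> is \<open>C\<^sup>1\<close> on \<open>S\<close>. Test functions are \<open>C\<^sup>1\<close> with
  compact support in \<open>S\<close>; by mollification, smooth ones give the same notion.
\<close>

definition has_weak_gradient_on ::
    "('a::euclidean_space \<Rightarrow> real) \<Rightarrow> ('a \<Rightarrow> 'a) \<Rightarrow> 'a set \<Rightarrow> bool"
  where "has_weak_gradient_on f g S \<longleftrightarrow>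
    (\<forall>K. compact K \<and> K \<subseteq> S \<longrightarrow> set_integrable lborel K f \<and> set_integrable lborel K g) \<and>
    (\<forall>\<phi> grad_\<phi>.
       (\<forall>x. GDERIV \<phi> x :> grad_\<phi> x) \<and> continuous_on UNIV grad_\<phi> \<and>
       (\<exists>K. compact K \<and> K \<subseteq> S \<and> (\<forall>x. x \<notin> K \<longrightarrow> \<phi> x = 0)) \<longrightarrow>
       (LINT x:S|lborel. f x *\<^sub>R grad_\<phi> x) = - (LINT x:S|lborel. \<phi> x *\<^sub>R g x))"

text \<open>
  \<open>C1_density\<close> alone does not relate the integral of \<open>|\<nabla>c|\<^sup>2\<close> to the variation of \<open>c\<close>. The
  density \<open>c = 2\<close> on \<open>(0, 1/2)\<^sup>2 \<union> (1/2, 1)\<^sup>2\<close>, \<open>c = 0\<close> elsewhere, has uniform marginals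
  and classical gradient 0 almost everywhere, but it is not the uniform density; so does
  the continuous density \<open>1 + (2 F x\<^sub>1 - 1) (2 F x\<^sub>2 - 1)\<close> on the unit square, where
  \<open>F\<close> is the Cantor function. Accordingly, \<open>\<nabla>c\<close> denotes a function that is the
  classical gradient on \<open>\<Omega>\<close> and the distributional gradient on the open unit square.
\<close>

end

theory Submission
  imports Defs
begin

text \<open>
  Only the vertical derivative of the density \<open>c\<close> is needed. Given a function \<open>p\<close> on the unit
  square, let \<open>H (x, y)\<close> be the primitive in \<open>y\<close>, vanishing at \<open>y = 0\<close>, of
  \<open>p (x, y) - \<integral> p (x, s) ds\<close>. It also vanishes at \<open>y = 1\<close>, and since \<open>V\<^sub>1\<close> is uniform the
  subtracted mean has expectation \<open>E p(U\<^sub>1, U\<^sub>2)\<close>; integrating by parts in \<open>y\<close>,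
  \<open>E p(V\<^sub>1, V\<^sub>2) - E p(U\<^sub>1, U\<^sub>2) = - \<integral> H \<partial>\<^sub>2c\<close>. If \<open>p\<close> is 1-Lipschitz then
  \<open>|H (x, y)| \<le> y (1 - y) / 2 \<le> 1/8\<close>, so that by Cauchy-Schwarz the difference is at most
  \<open>1/8\<close> times the \<open>L\<^sup>2\<close> norm of \<open>\<nabla>c\<close>, and \<open>1/8 \<le> 2 / \<pi>\<^sup>2\<close>. The integration by parts is done for
  monomials, whose potentials \<open>H\<close> are products, and a Lipschitz function is approximated uniformly
  by polynomials; the bound on \<open>H\<close> survives because it only uses the modulus of continuity.
\<close>

subsection \<open>Cutoff functions\<close>

text \<open>Squaring removes the kink of the positive part: at 0 the difference quotient is at most
  \<open>\<bar>h\<bar>\<close> in absolute value. The cutoffs below have to be C^1, because the test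
  functions for weak gradients are.\<close>

lemma has_real_derivative_max0_square:
  "((\<lambda>v::real. (max 0 v)\<^sup>2) has_real_derivative 2 * max 0 v) (at v)"
proof -
  consider "v > 0" | "v < 0" | "v = 0" by linarith
  then show ?thesis
  proof cases
    case 1
    have "((\<lambda>v::real. v\<^sup>2) has_real_derivative 2 * max 0 v) (at v)"
      using 1 by (auto intro!: derivative_eq_intros)
    then show ?thesis
      by (rule has_field_derivative_transform_within_open[where S = "{0<..}"]) (use 1 in auto)
  next
    case 2
    have "((\<lambda>v::real. 0) has_real_derivative 2 * max 0 v) (at v)"
      using 2 by (auto intro!: derivative_eq_intros)
    then show ?thesis
      by (rule has_field_derivative_transform_within_open[where S = "{..<0}"]) (use 2 in auto)
  next
    case 3
    have "((\<lambda>h. ((max 0 h)\<^sup>2) / h) \<longlongrightarrow> 0) (at (0::real))"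
    proof (rule Lim_null_comparison)
      show "\<forall>\<^sub>F h in at 0. norm ((max 0 h)\<^sup>2 / h) \<le> \<bar>h::real\<bar>"
        by (auto simp: eventually_at_filter max_def power2_eq_square)
      show "((\<lambda>h::real. \<bar>h\<bar>) \<longlongrightarrow> 0) (at 0)"
        by (auto intro!: tendsto_eq_intros)
    qed
    then show ?thesis
      using 3 by (simp add: has_field_derivative_iff)
  qed
qed

text \<open>
  A cutoff with \<open>u * cutoff' \<epsilon> u\<close> bounded uniformly in \<open>\<epsilon>\<close> and tending to 0: multiplying by
  it a function that vanishes linearly on the boundary keeps the derivatives dominated.
\<close>

definition cutoff :: "real \<Rightarrow> real \<Rightarrow> real"
  where "cutoff \<epsilon> u = (max 0 (u - \<epsilon>))\<^sup>2 / (u\<^sup>2 + \<epsilon>\<^sup>2)"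

definition cutoff' :: "real \<Rightarrow> real \<Rightarrow> real"
  where "cutoff' \<epsilon> u = 2 * max 0 (u - \<epsilon>) / (u\<^sup>2 + \<epsilon>\<^sup>2)
    - 2 * u * (max 0 (u - \<epsilon>))\<^sup>2 / (u\<^sup>2 + \<epsilon>\<^sup>2)\<^sup>2"

lemma cutoff_denominator_pos: "0 < \<epsilon> \<Longrightarrow> 0 < u\<^sup>2 + \<epsilon>\<^sup>2" for u \<epsilon> :: real
  by (intro add_nonneg_pos) auto

lemma cutoff_has_derivative:
  assumes "0 < \<epsilon>"
  shows "(cutoff \<epsilon> has_real_derivative cutoff' \<epsilon> u) (at u)"
proof -
  have nz: "u\<^sup>2 + \<epsilon>\<^sup>2 \<noteq> 0" using cutoff_denominator_pos[OF assms, of u] by linarith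
  have "((\<lambda>u. (max 0 (u - \<epsilon>))\<^sup>2) has_real_derivative 2 * max 0 (u - \<epsilon>) * 1) (at u)"
    by (rule DERIV_chain2[OF has_real_derivative_max0_square]) (auto intro!: derivative_eq_intros)
  moreover have "((\<lambda>u. u\<^sup>2 + \<epsilon>\<^sup>2) has_real_derivative 2 * u) (at u)"
    by (auto intro!: derivative_eq_intros)
  ultimately have "((\<lambda>u. (max 0 (u - \<epsilon>))\<^sup>2 / (u\<^sup>2 + \<epsilon>\<^sup>2)) has_real_derivative
      (2 * max 0 (u - \<epsilon>) * 1 * (u\<^sup>2 + \<epsilon>\<^sup>2) - (max 0 (u - \<epsilon>))\<^sup>2 * (2 * u))
        / ((u\<^sup>2 + \<epsilon>\<^sup>2) * (u\<^sup>2 + \<epsilon>\<^sup>2))) (at u)"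
    using nz by (rule DERIV_divide)
  also have "(2 * max 0 (u - \<epsilon>) * 1 * (u\<^sup>2 + \<epsilon>\<^sup>2) - (max 0 (u - \<epsilon>))\<^sup>2 * (2 * u))
        / ((u\<^sup>2 + \<epsilon>\<^sup>2) * (u\<^sup>2 + \<epsilon>\<^sup>2)) = cutoff' \<epsilon> u"
    unfolding cutoff'_def using nz by (simp add: diff_divide_distrib power2_eq_square[of "u\<^sup>2 + \<epsilon>\<^sup>2"])
  finally show ?thesis unfolding cutoff_def[abs_def] .
qed

lemma continuous_on_cutoff' [continuous_intros]:
  assumes "0 < \<epsilon>" "continuous_on A f"
  shows "continuous_on A (\<lambda>x. cutoff' \<epsilon> (f x))"
  unfolding cutoff'_def using cutoff_denominator_pos[OF assms(1)] assms(2)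
  by (auto intro!: continuous_intros simp: less_imp_neq[THEN not_sym])

lemma continuous_on_cutoff [continuous_intros]:
  assumes "0 < \<epsilon>" "continuous_on A f"
  shows "continuous_on A (\<lambda>x. cutoff \<epsilon> (f x))"
  unfolding cutoff_def using cutoff_denominator_pos[OF assms(1)] assms(2)
  by (auto intro!: continuous_intros simp: less_imp_neq[THEN not_sym])

lemma cutoff_eq_0: "u \<le> \<epsilon> \<Longrightarrow> cutoff \<epsilon> u = 0"
  by (simp add: cutoff_def)

lemma cutoff_bound:
  assumes "0 < \<epsilon>" "0 \<le> u"
  shows "\<bar>cutoff \<epsilon> u\<bar> \<le> 1"
proof -
  have "(max 0 (u - \<epsilon>))\<^sup>2 \<le> u\<^sup>2" using assms by (intro power_mono) auto
  also have "\<dots> \<le> u\<^sup>2 + \<epsilon>\<^sup>2" by simp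
  finally show ?thesis using cutoff_denominator_pos[OF assms(1)]
    by (auto simp: cutoff_def)
qed

lemma cutoff'_bound:
  assumes "0 < \<epsilon>" "0 \<le> u"
  shows "\<bar>u * cutoff' \<epsilon> u\<bar> \<le> 4"
proof -
  define d where "d = u\<^sup>2 + \<epsilon>\<^sup>2"
  define m where "m = max 0 (u - \<epsilon>)"
  have d: "0 < d" unfolding d_def using assms by (simp add: cutoff_denominator_pos)
  have m: "0 \<le> m" "m \<le> u" using assms by (auto simp: m_def)
  have um: "u * m \<le> d" using m assms by (auto simp: d_def power2_eq_square intro!: add_increasing2 mult_left_mono)
  have "m\<^sup>2 \<le> u\<^sup>2" using m by (intro power_mono) auto
  then have mm: "m\<^sup>2 \<le> d" by (simp add: d_def add_increasing2)
  have uu: "u\<^sup>2 \<le> d" by (simp add: d_def)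
  \<comment> \<open>All three quotients \<open>u * m / d\<close>, \<open>u\<^sup>2 / d\<close> and
    \<open>m\<^sup>2 / d\<close> lie in [0, 1], whatever \<open>\<epsilon>\<close> is; the constant
    4 is generous.\<close>
  have "u * cutoff' \<epsilon> u = 2 * (u * m / d) - 2 * ((u\<^sup>2 / d) * (m\<^sup>2 / d))"
    unfolding cutoff'_def d_def[symmetric] m_def[symmetric]
    by (simp add: power2_eq_square algebra_simps)
  moreover have "0 \<le> u * m / d" "u * m / d \<le> 1" using um d m assms by auto
  moreover have "0 \<le> (u\<^sup>2 / d) * (m\<^sup>2 / d)" "(u\<^sup>2 / d) * (m\<^sup>2 / d) \<le> 1"
    using uu mm d by (intro mult_nonneg_nonneg mult_le_one; simp)+
  ultimately show ?thesis by linarith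
qed

lemma cutoff_tendsto:
  assumes "0 < u" "\<epsilon> \<longlonglongrightarrow> 0"
  shows "(\<lambda>n. cutoff (\<epsilon> n) u) \<longlonglongrightarrow> 1"
proof -
  have "(\<lambda>n. cutoff (\<epsilon> n) u) \<longlonglongrightarrow> (max 0 (u - 0))\<^sup>2 / (u\<^sup>2 + 0\<^sup>2)"
    unfolding cutoff_def using assms by (intro tendsto_intros) auto
  then show ?thesis using assms by simp
qed

lemma cutoff'_tendsto:
  assumes "0 < u" "\<epsilon> \<longlonglongrightarrow> 0"
  shows "(\<lambda>n. cutoff' (\<epsilon> n) u) \<longlonglongrightarrow> 0"
proof -
  have "(\<lambda>n. cutoff' (\<epsilon> n) u) \<longlonglongrightarrow>
      2 * max 0 (u - 0) / (u\<^sup>2 + 0\<^sup>2) - 2 * u * (max 0 (u - 0))\<^sup>2 / (u\<^sup>2 + 0\<^sup>2)\<^sup>2"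
    unfolding cutoff'_def using assms by (intro tendsto_intros) auto
  then show ?thesis using assms by (simp add: power2_eq_square)
qed

subsection \<open>Integration by parts against a weak gradient\<close>

lemma set_integrable_bounded_mult:
  fixes g :: "'a::euclidean_space \<Rightarrow> 'b::euclidean_space"
  assumes "set_integrable lborel S g" "F \<in> borel_measurable borel" "S \<in> sets borel"
    and "\<And>z. z \<in> S \<Longrightarrow> \<bar>F z\<bar> \<le> C"
  shows "set_integrable lborel S (\<lambda>z. F z *\<^sub>R g z)"
proof -
  have m: "(\<lambda>z. indicator S z *\<^sub>R g z) \<in> borel_measurable lborel"
    using assms(1) by (auto simp: set_integrable_def)
  \<comment> \<open>Off \<open>S\<close> nothing is known about the measurability of
    \<open>g\<close> or the size of \<open>F\<close>, so each factor carries its own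
    indicator.\<close>
  have "integrable lborel (\<lambda>z. (indicator S z * F z) *\<^sub>R (indicator S z *\<^sub>R g z))"
  proof (rule Bochner_Integration.integrable_bound)
    show "integrable lborel (\<lambda>z. C *\<^sub>R (indicator S z *\<^sub>R g z))"
      using assms(1) unfolding set_integrable_def by (rule integrable_scaleR_right)
    show "(\<lambda>z. (indicator S z * F z) *\<^sub>R (indicator S z *\<^sub>R g z)) \<in> borel_measurable lborel"
      using assms(2,3) m by measurable
    show "AE z in lborel. norm ((indicator S z * F z) *\<^sub>R (indicator S z *\<^sub>R g z))
        \<le> norm (C *\<^sub>R (indicator S z *\<^sub>R g z))"
      using assms(4) by (auto simp: indicator_def intro!: mult_right_mono order_trans[OF _ abs_ge_self])
  qed
  then show ?thesis
    unfolding set_integrable_def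
    by (rule back_subst[where P = "integrable lborel"]) (auto simp: fun_eq_iff indicator_def)
qed

lemma set_integral_bounded_mult_tendsto:
  fixes g :: "'a::euclidean_space \<Rightarrow> real"
  assumes "set_integrable lborel S g" "\<And>n. F n \<in> borel_measurable borel" "G \<in> borel_measurable borel"
    and "S \<in> sets borel"
    and "\<And>n z. z \<in> S \<Longrightarrow> \<bar>F n z\<bar> \<le> C"
    and "\<And>z. z \<in> S \<Longrightarrow> (\<lambda>n. F n z) \<longlonglongrightarrow> G z"
  shows "(\<lambda>n. LINT z:S|lborel. F n z * g z) \<longlonglongrightarrow> (LINT z:S|lborel. G z * g z)"
  unfolding set_lebesgue_integral_def
proof (rule integral_dominated_convergence)
  have m: "(\<lambda>z. indicator S z *\<^sub>R g z) \<in> borel_measurable lborel"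
    using assms(1) by (auto simp: set_integrable_def)
  have "(\<lambda>z. G z * (indicator S z *\<^sub>R g z)) \<in> borel_measurable lborel"
    using assms(3) m by measurable
  then show "(\<lambda>z. indicator S z *\<^sub>R (G z * g z)) \<in> borel_measurable lborel"
    by (simp add: mult.left_commute)
  have "(\<lambda>z. F n z * (indicator S z *\<^sub>R g z)) \<in> borel_measurable lborel" for n
    using assms(2)[of n] m by measurable
  then show "(\<lambda>z. indicator S z *\<^sub>R (F n z * g z)) \<in> borel_measurable lborel" for n
    by (simp add: mult.left_commute)
  show "integrable lborel (\<lambda>z. C * norm (indicator S z *\<^sub>R g z))"
    using assms(1) unfolding set_integrable_def by (intro integrable_mult_right integrable_norm)
  show "AE z in lborel. (\<lambda>n. indicator S z *\<^sub>R (F n z * g z)) \<longlonglongrightarrow> indicator S z *\<^sub>R (G z * g z)"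
    using assms(6) by (auto simp: indicator_def intro!: tendsto_intros)
  show "AE z in lborel. norm (indicator S z *\<^sub>R (F n z * g z)) \<le> C * norm (indicator S z *\<^sub>R g z)" for n
    using assms(5) by (auto simp: indicator_def abs_mult intro!: mult_right_mono)
qed

text \<open>The product \<open>a (fst z) * b (snd z)\<close> is an admissible test function
  supported in \<open>K \<times> L\<close>, and the second component of the vector identity defining
  the weak gradient is the claim. The derivative \<open>a'\<close> enters only the first component
  and so disappears.\<close>

lemma weak_gradient_product_test:
  fixes f :: "real \<times> real \<Rightarrow> real" and g :: "real \<times> real \<Rightarrow> real \<times> real"
  assumes wg: "has_weak_gradient_on f g S"
    and S: "bounded S" "S \<in> sets borel"
    and f: "set_integrable lborel S f" and g: "set_integrable lborel S g"
    and a: "\<And>x. (a has_real_derivative a' x) (at x)" "continuous_on UNIV a'"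
    and b: "\<And>x. (b has_real_derivative b' x) (at x)" "continuous_on UNIV b'"
    and K: "compact K" "compact L" "K \<times> L \<subseteq> S" "\<And>x. x \<notin> K \<Longrightarrow> a x = 0" "\<And>x. x \<notin> L \<Longrightarrow> b x = 0"
  shows "(LINT z:S|lborel. a (fst z) * b' (snd z) * f z)
    = - (LINT z:S|lborel. a (fst z) * b (snd z) * snd (g z))"
proof -
  define \<phi> where "\<phi> z = a (fst z) * b (snd z)" for z
  define \<phi>' where "\<phi>' z = (a' (fst z) * b (snd z), a (fst z) * b' (snd z))" for z
  have ca: "continuous_on UNIV a" and cb: "continuous_on UNIV b"
    using a(1) b(1) by (meson DERIV_isCont continuous_at_imp_continuous_on)+
  have cont: "continuous_on X (\<lambda>z::real\<times>real. u (fst z))" "continuous_on X (\<lambda>z::real\<times>real. u (snd z))"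
    if "continuous_on UNIV u" for u :: "real \<Rightarrow> real" and X
    by (auto intro!: continuous_on_compose2[OF that] continuous_intros)
  have c\<phi>: "continuous_on UNIV \<phi>" and c\<phi>': "continuous_on UNIV \<phi>'"
    unfolding \<phi>_def \<phi>'_def using ca cb a(2) b(2) by (auto intro!: continuous_intros cont)
  have "GDERIV \<phi> z :> \<phi>' z" for z
  proof -
    have "((\<lambda>z. a (fst z)) has_derivative (\<lambda>h. fst h * a' (fst z))) (at z)"
      using has_derivative_compose[OF bounded_linear_imp_has_derivative[OF bounded_linear_fst, of "at z"]
          a(1)[of "fst z", unfolded has_field_derivative_def]]
      by (simp add: mult.commute)
    moreover have "((\<lambda>z. b (snd z)) has_derivative (\<lambda>h. snd h * b' (snd z))) (at z)"
      using has_derivative_compose[OF bounded_linear_imp_has_derivative[OF bounded_linear_snd, of "at z"]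
          b(1)[of "snd z", unfolded has_field_derivative_def]]
      by (simp add: mult.commute)
    ultimately show ?thesis
      unfolding gderiv_def \<phi>_def \<phi>'_def
      by (auto intro!: derivative_eq_intros simp: fun_eq_iff inner_prod_def algebra_simps)
  qed
  moreover have "\<exists>K. compact K \<and> K \<subseteq> S \<and> (\<forall>x. x \<notin> K \<longrightarrow> \<phi> x = 0)"
    using K by (intro exI[of _ "K \<times> L"]) (auto simp: compact_Times \<phi>_def mem_Times_iff)
  ultimately have eq: "(LINT z:S|lborel. f z *\<^sub>R \<phi>' z) = - (LINT z:S|lborel. \<phi> z *\<^sub>R g z)"
    using wg c\<phi>' unfolding has_weak_gradient_on_def by blast
  have bnd: "\<exists>C. \<forall>z\<in>S. norm (F z) \<le> C" if "continuous_on UNIV F" for F :: "real \<times> real \<Rightarrow> real"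
  proof -
    have "compact (closure S)" using S by (simp add: compact_closure)
    then have "bounded (F ` closure S)"
      using that by (intro compact_imp_bounded compact_continuous_image) (auto intro: continuous_on_subset)
    then show ?thesis unfolding bounded_iff using closure_subset by blast
  qed
  have meas: "F \<in> borel_measurable borel" if "continuous_on UNIV F" for F :: "real \<times> real \<Rightarrow> real"
    using that by (rule borel_measurable_continuous_onI)
  have c1: "continuous_on UNIV (\<lambda>z. fst (\<phi>' z))" and c2: "continuous_on UNIV (\<lambda>z. snd (\<phi>' z))"
    using c\<phi>' by (auto intro!: continuous_intros)
  obtain C C1 C2 where C: "\<forall>z\<in>S. norm (\<phi> z) \<le> C" "\<forall>z\<in>S. norm (fst (\<phi>' z)) \<le> C1" "\<forall>z\<in>S. norm (snd (\<phi>' z)) \<le> C2"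
    using bnd c\<phi> c1 c2 by metis
  \<comment> \<open>Moving \<open>snd\<close> inside a Bochner integral needs an integrable
    integrand. Continuous factors are bounded on \<open>S\<close>, whose closure is compact, so the
    integrability of \<open>f\<close> and \<open>g\<close> on \<open>S\<close> suffices.\<close>
  have i1: "set_integrable lborel S (\<lambda>z. \<phi> z *\<^sub>R g z)"
    by (rule set_integrable_bounded_mult[OF g meas[OF c\<phi>] S(2), of C]) (use C in auto)
  have i2: "set_integrable lborel S (\<lambda>z. fst (\<phi>' z) *\<^sub>R f z)"
    by (rule set_integrable_bounded_mult[OF f meas[OF c1] S(2), of C1]) (use C in auto)
  have i3: "set_integrable lborel S (\<lambda>z. snd (\<phi>' z) *\<^sub>R f z)"
    by (rule set_integrable_bounded_mult[OF f meas[OF c2] S(2), of C2]) (use C in auto)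
  have "integrable lborel (\<lambda>z. (indicator S z *\<^sub>R (fst (\<phi>' z) *\<^sub>R f z)) *\<^sub>R (1::real, 0::real)
      + (indicator S z *\<^sub>R (snd (\<phi>' z) *\<^sub>R f z)) *\<^sub>R (0, 1))"
    using i2 i3 unfolding set_integrable_def
    by (intro Bochner_Integration.integrable_add integrable_scaleR_left)
  then have i4: "set_integrable lborel S (\<lambda>z. f z *\<^sub>R \<phi>' z)"
    unfolding set_integrable_def
    by (rule back_subst[where P = "integrable lborel"])
      (auto simp: fun_eq_iff prod_eq_iff)
  have "snd (LINT z:S|lborel. f z *\<^sub>R \<phi>' z) = (LINT z:S|lborel. snd (f z *\<^sub>R \<phi>' z))"
    using integral_bounded_linear[OF bounded_linear_snd i4[unfolded set_integrable_def]]
    by (simp add: set_lebesgue_integral_def mult.assoc)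
  moreover have "snd (LINT z:S|lborel. \<phi> z *\<^sub>R g z) = (LINT z:S|lborel. snd (\<phi> z *\<^sub>R g z))"
    using integral_bounded_linear[OF bounded_linear_snd i1[unfolded set_integrable_def]]
    by (simp add: set_lebesgue_integral_def mult.assoc)
  ultimately show ?thesis
    using arg_cong[OF eq, of snd] by (simp add: \<phi>_def \<phi>'_def mult_ac)
qed

text \<open>Along a compact exhaustion the truncations of \<open>g\<close> are eventually constant
  at each point. A weak gradient is a priori integrable only on compact subsets, and this makes it
  measurable on the whole open set before any global integrability is known.\<close>

lemma set_borel_measurable_open_exhaustion:
  fixes g :: "'a::euclidean_space \<Rightarrow> 'b::euclidean_space"
  assumes "open S" "\<And>K. compact K \<Longrightarrow> K \<subseteq> S \<Longrightarrow> set_borel_measurable lborel K g"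
  shows "set_borel_measurable lborel S g"
proof -
  obtain C where C: "\<And>n. compact (C n)" "\<And>n. C n \<subseteq> S" "\<And>n. C n \<subseteq> interior (C (Suc n))"
    "\<Union>(range C) = S"
    using open_Union_compact_subsets[OF assms(1)] by metis
  have mono: "C m \<subseteq> C n" if "m \<le> n" for m n
    using that by (rule lift_Suc_mono_le[rotated]) (use C(3) interior_subset in blast)
  show ?thesis
    unfolding set_borel_measurable_def
  proof (rule borel_measurable_LIMSEQ_metric)
    show "(\<lambda>x. indicator (C n) x *\<^sub>R g x) \<in> borel_measurable lborel" for n
      using assms(2)[OF C(1,2)] by (simp add: set_borel_measurable_def)
    show "(\<lambda>n. indicator (C n) x *\<^sub>R g x) \<longlonglongrightarrow> indicator S x *\<^sub>R g x" for x
    proof (cases "x \<in> S")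
      case True
      then obtain m where "x \<in> C m" using C(4) by auto
      then have "eventually (\<lambda>n. indicator (C n) x *\<^sub>R g x = indicator S x *\<^sub>R g x) sequentially"
        using True mono by (intro eventually_sequentiallyI[of m]) (auto simp: indicator_def)
      then show ?thesis by (rule tendsto_eventually)
    next
      case False
      then have "x \<notin> C n" for n using C(2) by auto
      then show ?thesis using False by simp
    qed
  qed
qed

text \<open>The factor multiplying \<open>f\<close> is the \<open>y\<close>-derivative of the one
  multiplying \<open>snd (g z)\<close>. The latter is not compactly supported in \<open>Q\<close>,
  so both variables are cut off near the boundary and the cutoff is removed by dominated
  convergence. Only the \<open>y\<close>-cutoff gets differentiated, which is why a factor vanishing
  on the boundary is required in \<open>y\<close> but not in \<open>x\<close>.\<close>

lemma weak_gradient_vertical_integration_by_parts: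
  fixes f :: "real \<times> real \<Rightarrow> real" and g :: "real \<times> real \<Rightarrow> real \<times> real"
  defines "Q \<equiv> {0<..<1} \<times> {0<..<1}"
  assumes wg: "has_weak_gradient_on f g Q"
    and f: "set_integrable lborel Q f" and g: "set_integrable lborel Q g"
    and a: "\<And>x. (a has_real_derivative a' x) (at x)" "continuous_on UNIV a'"
    and s: "\<And>x. (s has_real_derivative s' x) (at x)" "continuous_on UNIV s'"
  shows "(LINT z:Q|lborel. a (fst z) * ((1 - 2 * snd z) * s (snd z) + snd z * (1 - snd z) * s' (snd z)) * f z)
    = - (LINT z:Q|lborel. a (fst z) * (snd z * (1 - snd z) * s (snd z)) * snd (g z))"
proof -
  define q :: "real \<Rightarrow> real" where "q y = y * (1 - y)" for y
  define b where "b y = q y * s y" for y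
  define b' where "b' y = (1 - 2 * y) * s y + q y * s' y" for y
  define e :: "nat \<Rightarrow> real" where "e n = inverse (real (Suc n))" for n
  define A where "A n x = cutoff (e n) (q x) * a x" for n x
  define A' where "A' n x = cutoff' (e n) (q x) * (1 - 2 * x) * a x + cutoff (e n) (q x) * a' x" for n x
  define B where "B n y = cutoff (e n) (q y) * b y" for n y
  \<comment> \<open>Since \<open>b = q * s\<close>, the derivative of the cutoff occurs only in the
    product \<open>q y * cutoff' (e n) (q y)\<close>, which is bounded uniformly in
    \<open>n\<close>.\<close>
  define B' where "B' n y = (q y * cutoff' (e n) (q y)) * ((1 - 2 * y) * s y) + cutoff (e n) (q y) * b' y" for n y
  \<comment> \<open>Positivity of \<open>q\<close> characterises the open unit interval, so this
    superlevel set is compact inside it; outside it the cutoff vanishes.\<close>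
  define K where "K n = {x. e n \<le> q x}" for n
  have e: "0 < e n" for n by (simp add: e_def)
  have e0: "e \<longlonglongrightarrow> 0" unfolding e_def[abs_def] by (rule LIMSEQ_inverse_real_of_nat)
  have ca: "continuous_on UNIV a" and cs: "continuous_on UNIV s"
    using a(1) s(1) by (meson DERIV_isCont continuous_at_imp_continuous_on)+
  have cq: "continuous_on UNIV q" unfolding q_def by (intro continuous_intros)
  have cb: "continuous_on UNIV b" "continuous_on UNIV b'"
    unfolding b_def b'_def using cs cq s(2) by (auto intro!: continuous_intros)
  have cA: "continuous_on UNIV (A n)" "continuous_on UNIV (A' n)"
    and cB: "continuous_on UNIV (B n)" "continuous_on UNIV (B' n)" for n
    unfolding A_def A'_def B_def B'_def using e ca cs cq cb a(2) s(2)
    by (auto intro!: continuous_intros)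
  have dq: "(q has_real_derivative (1 - 2 * x)) (at x)" for x
    unfolding q_def by (auto intro!: derivative_eq_intros)
  have dcq: "((\<lambda>x. cutoff (e n) (q x)) has_real_derivative cutoff' (e n) (q x) * (1 - 2 * x)) (at x)" for n x
    by (rule DERIV_chain2[OF cutoff_has_derivative[OF e] dq])
  have dA: "(A n has_real_derivative A' n x) (at x)" for n x
    unfolding A_def A'_def using DERIV_mult[OF dcq a(1)] by (simp add: mult_ac)
  have db: "(b has_real_derivative b' x) (at x)" for x
    unfolding b_def b'_def using DERIV_mult[OF dq s(1)] by (simp add: mult_ac)
  have dB: "(B n has_real_derivative B' n x) (at x)" for n x
    unfolding B_def B'_def using DERIV_mult[OF dcq db, of n x] by (simp add: mult_ac b_def)
  have q01: "x \<in> {0<..<1}" if "0 < q x" for x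
    using that by (auto simp: q_def zero_less_mult_iff)
  have qpos: "0 < q x" "q x \<le> 1" if "x \<in> {0<..<1}" for x
    using that by (auto simp: q_def intro!: mult_le_one)
  have K01: "K n \<subseteq> {0<..<1}" for n
    using e[of n] q01 by (auto simp: K_def dest: less_le_trans)
  have KQ: "K n \<times> K n \<subseteq> Q" for n
    using K01[of n] unfolding Q_def by (rule Sigma_mono) (rule K01)
  have cK: "compact (K n)" for n
    unfolding compact_eq_bounded_closed
  proof
    show "bounded (K n)" using K01 by (rule bounded_subset[rotated]) simp
    show "closed (K n)" unfolding K_def using cq by (intro closed_Collect_le continuous_intros)
  qed
  have AB0: "A n x = 0" "B n x = 0" if "x \<notin> K n" for n x
    using that by (auto simp: A_def B_def K_def cutoff_eq_0)
  have bQ: "bounded Q" "Q \<in> sets borel"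
    unfolding Q_def by (auto intro!: bounded_Times borel_open open_Times)
  have ibp: "(LINT z:Q|lborel. A n (fst z) * B' n (snd z) * f z)
      = - (LINT z:Q|lborel. A n (fst z) * B n (snd z) * snd (g z))" for n
    by (rule weak_gradient_product_test[OF wg bQ f g dA cA(2) dB cB(2) cK cK KQ AB0])
  have bnd: "\<exists>C. \<forall>x\<in>{0<..<1}. \<bar>u x\<bar> \<le> C" if "continuous_on UNIV u" for u :: "real \<Rightarrow> real"
  proof -
    have "bounded (u ` {0..1})"
      using that by (intro compact_imp_bounded compact_continuous_image) (auto intro: continuous_on_subset)
    then obtain C where "\<forall>x\<in>{0..1}. \<bar>u x\<bar> \<le> C" unfolding bounded_iff by auto
    then show ?thesis by (intro exI[of _ C]) auto
  qed
  have "continuous_on UNIV (\<lambda>y. (1 - 2 * y) * s y)" using cs by (intro continuous_intros)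
  from bnd[OF this] obtain Cs where Cs: "\<forall>x\<in>{0<..<1}. \<bar>(1 - 2 * x) * s x\<bar> \<le> Cs" ..
  obtain Ca where Ca: "\<forall>x\<in>{0<..<1}. \<bar>a x\<bar> \<le> Ca" using bnd[OF ca] ..
  obtain Cb where Cb: "\<forall>x\<in>{0<..<1}. \<bar>b x\<bar> \<le> Cb" using bnd[OF cb(1)] ..
  obtain Cb' where Cb': "\<forall>x\<in>{0<..<1}. \<bar>b' x\<bar> \<le> Cb'" using bnd[OF cb(2)] ..
  note C = Ca Cb Cb' Cs
  have bA: "\<bar>A n x\<bar> \<le> Ca" if "x \<in> {0<..<1}" for n x
    using mult_mono[OF cutoff_bound[OF e, of "q x" n] C(1)[rule_format, OF that]] qpos[OF that]
    by (simp add: A_def abs_mult)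
  have bB: "\<bar>B n x\<bar> \<le> Cb" if "x \<in> {0<..<1}" for n x
    using mult_mono[OF cutoff_bound[OF e, of "q x" n] C(2)[rule_format, OF that]] qpos[OF that]
    by (simp add: B_def abs_mult)
  have bB': "\<bar>B' n x\<bar> \<le> 4 * Cs + Cb'" if "x \<in> {0<..<1}" for n x
  proof -
    have "\<bar>(q x * cutoff' (e n) (q x)) * ((1 - 2 * x) * s x)\<bar> \<le> 4 * Cs"
      unfolding abs_mult[of "q x * cutoff' (e n) (q x)"]
      using cutoff'_bound[OF e, of "q x" n] C(4)[rule_format, OF that] qpos[OF that]
      by (intro mult_mono) auto
    moreover have "\<bar>cutoff (e n) (q x) * b' x\<bar> \<le> 1 * Cb'"
      unfolding abs_mult
      using cutoff_bound[OF e, of "q x" n] C(3)[rule_format, OF that] qpos[OF that]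
      by (intro mult_mono) auto
    ultimately show ?thesis unfolding B'_def by linarith
  qed
  have cont: "continuous_on X (\<lambda>z::real\<times>real. u (fst z))" "continuous_on X (\<lambda>z::real\<times>real. u (snd z))"
    if "continuous_on UNIV u" for u :: "real \<Rightarrow> real" and X
    by (auto intro!: continuous_on_compose2[OF that] continuous_intros)
  have meas: "(\<lambda>z. u (fst z) * v (snd z)) \<in> borel_measurable borel"
    if "continuous_on UNIV u" "continuous_on UNIV v" for u v :: "real \<Rightarrow> real"
    using that by (intro borel_measurable_continuous_onI continuous_intros cont)
  \<comment> \<open>On the open interval \<open>q x\<close> is positive, so the cutoff tends to 1
    and the extra term that its derivative contributes tends to 0.\<close>
  have lc: "(\<lambda>n. cutoff (e n) (q x)) \<longlonglongrightarrow> 1" and lc': "(\<lambda>n. q x * cutoff' (e n) (q x)) \<longlonglongrightarrow> 0"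
    if "x \<in> {0<..<1}" for x
    using cutoff_tendsto[OF qpos(1)[OF that] e0] tendsto_mult_right_zero[OF cutoff'_tendsto[OF qpos(1)[OF that] e0]]
    by auto
  have lA: "(\<lambda>n. A n x) \<longlonglongrightarrow> a x" and lB: "(\<lambda>n. B n x) \<longlonglongrightarrow> b x" and lB': "(\<lambda>n. B' n x) \<longlonglongrightarrow> b' x"
    if "x \<in> {0<..<1}" for x
    using tendsto_mult[OF lc[OF that] tendsto_const, of "a x"] tendsto_mult[OF lc[OF that] tendsto_const, of "b x"]
      tendsto_add[OF tendsto_mult[OF lc'[OF that] tendsto_const, of "(1 - 2 * x) * s x"]
        tendsto_mult[OF lc[OF that] tendsto_const, of "b' x"]]
    by (simp_all add: A_def B_def B'_def)
  have sg: "set_integrable lborel Q (\<lambda>z. snd (g z))"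
    using integrable_bounded_linear[OF bounded_linear_snd g[unfolded set_integrable_def]]
    by (simp add: set_integrable_def)
  have "(\<lambda>n. LINT z:Q|lborel. A n (fst z) * B' n (snd z) * f z)
      \<longlonglongrightarrow> (LINT z:Q|lborel. a (fst z) * b' (snd z) * f z)"
  proof (rule set_integral_bounded_mult_tendsto[OF f meas meas bQ(2)])
    show "\<bar>A n (fst z) * B' n (snd z)\<bar> \<le> Ca * (4 * Cs + Cb')" if "z \<in> Q" for n z
    proof -
      have z: "fst z \<in> {0<..<1}" "snd z \<in> {0<..<1}" using that by (auto simp: Q_def)
      show ?thesis unfolding abs_mult
        using bA[OF z(1), of n] bB'[OF z(2), of n] by (intro mult_mono) auto
    qed
    show "(\<lambda>n. A n (fst z) * B' n (snd z)) \<longlonglongrightarrow> a (fst z) * b' (snd z)" if "z \<in> Q" for z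
      using that by (intro tendsto_mult lA lB') (auto simp: Q_def)
  qed (use cA cB ca cb in auto)
  moreover have "(\<lambda>n. LINT z:Q|lborel. A n (fst z) * B n (snd z) * snd (g z))
      \<longlonglongrightarrow> (LINT z:Q|lborel. a (fst z) * b (snd z) * snd (g z))"
  proof (rule set_integral_bounded_mult_tendsto[OF sg meas meas bQ(2)])
    show "\<bar>A n (fst z) * B n (snd z)\<bar> \<le> Ca * Cb" if "z \<in> Q" for n z
    proof -
      have z: "fst z \<in> {0<..<1}" "snd z \<in> {0<..<1}" using that by (auto simp: Q_def)
      show ?thesis unfolding abs_mult
        using bA[OF z(1), of n] bB[OF z(2), of n] by (intro mult_mono) auto
    qed
    show "(\<lambda>n. A n (fst z) * B n (snd z)) \<longlonglongrightarrow> a (fst z) * b (snd z)" if "z \<in> Q" for z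
      using that by (intro tendsto_mult lA lB) (auto simp: Q_def)
  qed (use cA cB ca cb in auto)
  ultimately have "(LINT z:Q|lborel. a (fst z) * b' (snd z) * f z)
      = - (LINT z:Q|lborel. a (fst z) * b (snd z) * snd (g z))"
    unfolding ibp by (intro LIMSEQ_unique[OF _ tendsto_minus])
  then show ?thesis unfolding b_def b'_def q_def .
qed

subsection \<open>Functions vanishing at both ends of the unit interval\<close>

text \<open>
  Compare \<open>u\<close> on both sides of \<open>y\<close> with the line of slope \<open>k = u' y\<close>, and combine the two
  estimates with weights \<open>1 - y\<close> and \<open>y\<close>, which eliminates \<open>k\<close>.
\<close>

lemma pinned_upper_bound:
  fixes u u' :: "real \<Rightarrow> real"
  assumes u: "\<And>s. (u has_real_derivative u' s) (at s)" "u 0 = 0" "u 1 = 0" and y: "y \<in> {0..1}"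
    and osc: "\<And>s. s \<in> {0..1} \<Longrightarrow> \<bar>u' s - u' y\<bar> \<le> \<bar>s - y\<bar> + d"
  shows "u y \<le> (1 / 2 + 2 * d) * (y * (1 - y))"
proof -
  define k where "k = u' y"
  \<comment> \<open>The terms after \<open>k * s\<close> integrate the largest deviation of
    \<open>u'\<close> from \<open>k\<close> that \<open>osc\<close> allows, so \<open>F\<close> is
    nonincreasing on [0, y] and \<open>G\<close> is nondecreasing on [y, 1].\<close>
  define F where "F s = u s - k * s - (y * s - s\<^sup>2 / 2) - d * s" for s
  define G where "G s = u s - k * s + (s\<^sup>2 / 2 - y * s) + d * s" for s
  have dF: "(F has_real_derivative u' s - k - (y - s) - d) (at s)" for s
    unfolding F_def by (auto intro!: derivative_eq_intros u)
  have dG: "(G has_real_derivative u' s - k + (s - y) + d) (at s)" for s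
    unfolding G_def by (auto intro!: derivative_eq_intros u)
  have "F y \<le> F 0"
  proof (rule DERIV_nonpos_imp_nonincreasing[where f = F])
    fix s assume "0 \<le> s" "s \<le> y"
    then show "\<exists>t. (F has_real_derivative t) (at s) \<and> t \<le> 0"
      using dF[of s] osc[of s] y by (intro exI[of _ "u' s - k - (y - s) - d"]) (auto simp: k_def abs_if split: if_splits)
  qed (use y in auto)
  then have 1: "u y - k * y \<le> y\<^sup>2 / 2 + d * y"
    by (simp add: F_def u power2_eq_square)
  have "G y \<le> G 1"
  proof (rule DERIV_nonneg_imp_nondecreasing[where f = G])
    fix s assume "y \<le> s" "s \<le> 1"
    then show "\<exists>t. (G has_real_derivative t) (at s) \<and> 0 \<le> t"
      using dG[of s] osc[of s] y by (intro exI[of _ "u' s - k + (s - y) + d"]) (auto simp: k_def abs_if split: if_splits)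
  qed (use y in auto)
  then have 2: "u y - k * y + k \<le> (1 - y)\<^sup>2 / 2 + d * (1 - y)"
    by (simp add: G_def u power2_eq_square field_simps)
  have "u y = (1 - y) * (u y - k * y) + y * (u y - k * y + k)"
    by (simp add: algebra_simps)
  also have "\<dots> \<le> (1 - y) * (y\<^sup>2 / 2 + d * y) + y * ((1 - y)\<^sup>2 / 2 + d * (1 - y))"
    using add_mono[OF mult_left_mono[OF 1, of "1 - y"] mult_left_mono[OF 2, of y]] y by simp
  also have "\<dots> = (1 / 2 + 2 * d) * (y * (1 - y))"
    by (simp add: power2_eq_square field_simps)
  finally show ?thesis .
qed

text \<open>The one-sided bound is applied to \<open>u\<close> and \<open>- u\<close>, and
  \<open>y * (1 - y)\<close> is at most 1/4. The slack \<open>d\<close> leaves room for a derivative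
  that is only uniformly close to a 1-Lipschitz function.\<close>

lemma pinned_bound:
  fixes u u' :: "real \<Rightarrow> real"
  assumes u: "\<And>s. (u has_real_derivative u' s) (at s)" "u 0 = 0" "u 1 = 0" and y: "y \<in> {0..1}"
    and osc: "\<And>s. s \<in> {0..1} \<Longrightarrow> \<bar>u' s - u' y\<bar> \<le> \<bar>s - y\<bar> + d"
  shows "\<bar>u y\<bar> \<le> 1 / 8 + d / 2"
proof -
  have "\<bar>u y\<bar> \<le> (1 / 2 + 2 * d) * (y * (1 - y))"
  proof (rule abs_leI)
    show "u y \<le> (1 / 2 + 2 * d) * (y * (1 - y))"
      using assms by (rule pinned_upper_bound)
    have "- u' s - - u' y = - (u' s - u' y)" for s by simp
    then show "- u y \<le> (1 / 2 + 2 * d) * (y * (1 - y))"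
      using u osc by (intro pinned_upper_bound[OF DERIV_minus[OF u(1)] _ _ y]) (simp_all only: abs_minus_cancel minus_zero)
  qed
  also have "\<dots> \<le> (1 / 2 + 2 * d) * (1 / 4)"
  proof (rule mult_left_mono)
    have "0 \<le> (y - 1 / 2)\<^sup>2" by simp
    then show "y * (1 - y) \<le> 1 / 4" by (simp add: power2_eq_square algebra_simps)
    \<comment> \<open>The case \<open>s = y\<close> of \<open>osc\<close> forces \<open>d\<close> to
      be nonnegative.\<close>
    show "0 \<le> 1 / 2 + 2 * d" using osc[OF y] by simp
  qed
  finally show ?thesis by (simp add: algebra_simps)
qed

subsection \<open>Bivariate polynomials\<close>

lemma poly_antiderivative:
  fixes r :: "'a::field_char_0 poly"
  obtains R where "pderiv R = r"
proof
  have "pderiv (\<Sum>i\<le>degree r. monom (coeff r i / of_nat (Suc i)) (Suc i))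
      = (\<Sum>i\<le>degree r. monom (coeff r i) i)"
    by (simp add: higher_pderiv_sum[of 1, simplified] pderiv_monom del: of_nat_Suc)
  then show "pderiv (\<Sum>i\<le>degree r. monom (coeff r i / of_nat (Suc i)) (Suc i)) = r"
    by (simp add: poly_as_sum_of_monoms)
qed

text \<open>The roots 0 and 1 are divided out in turn; \<open>[:0, 1, -1:]\<close> is X (1 - X).
  This provides the boundary factor needed for the integration by parts.\<close>

lemma poly_vanishing_at_0_1:
  fixes B :: "'a::field poly"
  assumes "poly B 0 = 0" "poly B 1 = 0"
  obtains S where "B = [:0, 1, -1:] * S"
proof -
  obtain C where C: "B = [:0, 1:] * C"
    using assms(1) by (auto simp: poly_eq_0_iff_dvd elim: dvdE)
  then have "poly C 1 = 0" using assms(2) by simp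
  then obtain D where D: "C = [:-1, 1:] * D"
    by (auto simp: poly_eq_0_iff_dvd elim: dvdE)
  show ?thesis
    by (rule that[of "- D"]) (simp add: C D algebra_simps)
qed

text \<open>The outer variable is the first coordinate and the coefficients are polynomials in the
  second, so that \<open>pCons r P\<close> stands for r(y) + x P(x, y).\<close>

definition bipoly :: "real poly poly \<Rightarrow> real \<times> real \<Rightarrow> real"
  where "bipoly P z = poly (poly P [:fst z:]) (snd z)"

lemma continuous_on_bipoly: "continuous_on S (bipoly P)"
proof (induction P)
  case (pCons r P)
  then show ?case
    unfolding bipoly_def[abs_def] by (auto intro!: continuous_intros)
qed (simp add: bipoly_def[abs_def])

text \<open>Stone-Weierstrass: \<open>[:0, 1:]\<close> and \<open>[:[:0, 1:]:]\<close> are the two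
  coordinate functions, which separate points.\<close>

lemma bipoly_dense:
  assumes "continuous_on S f" "compact S" "0 < e"
  obtains P where "\<And>z. z \<in> S \<Longrightarrow> \<bar>f z - bipoly P z\<bar> < e"
proof -
  have "\<exists>g. g \<in> range bipoly \<and> (\<forall>z\<in>S. \<bar>f z - g z\<bar> < e)"
  proof (rule Stone_Weierstrass_HOL[OF assms(2)])
    show "(\<lambda>_. k) \<in> range bipoly" for k
      by (rule range_eqI[of _ _ "[:[:k:]:]"]) (simp add: bipoly_def fun_eq_iff)
    show "continuous_on S g" if "g \<in> range bipoly" for g
      using that by (auto intro: continuous_on_bipoly)
    show "(\<lambda>z. g z + h z) \<in> range bipoly" if gh: "g \<in> range bipoly \<and> h \<in> range bipoly" for g h
    proof -
      obtain P R where "g = bipoly P" "h = bipoly R" using gh by auto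
      then show ?thesis
        by (intro range_eqI[of _ _ "P + R"]) (simp add: bipoly_def fun_eq_iff)
    qed
    show "(\<lambda>z. g z * h z) \<in> range bipoly" if gh: "g \<in> range bipoly \<and> h \<in> range bipoly" for g h
    proof -
      obtain P R where "g = bipoly P" "h = bipoly R" using gh by auto
      then show ?thesis
        by (intro range_eqI[of _ _ "P * R"]) (simp add: bipoly_def fun_eq_iff)
    qed
    show "\<exists>g. g \<in> range bipoly \<and> g z \<noteq> g w" if zw: "z \<in> S \<and> w \<in> S \<and> z \<noteq> w" for z w
    proof (cases "fst z = fst w")
      case True
      then show ?thesis
        using zw by (intro exI[of _ "bipoly [:[:0, 1:]:]"]) (auto simp: bipoly_def prod_eq_iff)
    next
      case False
      then show ?thesis
        by (intro exI[of _ "bipoly [:0, 1:]"]) (auto simp: bipoly_def)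
    qed
  qed (use assms in auto)
  then show ?thesis using that by blast
qed

subsection \<open>Comparison of a copula with the independence copula\<close>

lemma AE_uniform_in_unit:
  fixes X :: "'c \<Rightarrow> real"
  assumes "X \<in> borel_measurable L" "distr L lborel X = uniform_measure lborel {0..1}"
  shows "AE \<omega> in L. X \<omega> \<in> {0<..<1}"
proof -
  have "AE x in uniform_measure lborel {0..1}. x \<in> {0<..<1::real}"
  proof (rule AE_uniform_measureI)
    show "AE x in lborel. x \<in> {0..1} \<longrightarrow> x \<in> {0<..<1::real}"
      using AE_lborel_singleton[of "0::real"] AE_lborel_singleton[of "1::real"]
      by eventually_elim auto
  qed simp
  then show ?thesis
    unfolding assms(2)[symmetric] by (rule AE_distrD[rotated]) (use assms(1) in simp)
qed

text \<open>Here the gradient is assumed integrable on the open square; the theorem obtains this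
  from the finiteness of the integral of its square.\<close>

locale copula_density = M: prob_space M + N: prob_space N
  for M :: "'a measure" and N :: "'b measure" +
  fixes V1 V2 :: "'a \<Rightarrow> real" and U1 U2 :: "'b \<Rightarrow> real"
    and c :: "real \<times> real \<Rightarrow> real" and grad_c :: "real \<times> real \<Rightarrow> real \<times> real"
    and Q :: "(real \<times> real) set"
  defines "Q \<equiv> {0<..<1} \<times> {0<..<1}"
  assumes V_measurable [measurable]: "V1 \<in> borel_measurable M" "V2 \<in> borel_measurable M"
    and V_uniform: "distr M lborel V1 = uniform_measure lborel {0..1}"
      "distr M lborel V2 = uniform_measure lborel {0..1}"
    and c_nonneg: "\<And>x. 0 \<le> c x"
    and c_density: "distributed M lborel (\<lambda>\<omega>. (V1 \<omega>, V2 \<omega>)) (\<lambda>x. ennreal (c x))"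
    and weak_gradient: "has_weak_gradient_on c grad_c Q"
    and gradient_integrable: "set_integrable lborel Q grad_c"
    and U_measurable [measurable]: "U1 \<in> borel_measurable N" "U2 \<in> borel_measurable N"
    and U_uniform: "distr N lborel U1 = uniform_measure lborel {0..1}"
      "distr N lborel U2 = uniform_measure lborel {0..1}"
    and U_indep: "N.indep_var borel U1 borel U2"
begin

lemma AE_V: "AE \<omega> in M. (V1 \<omega>, V2 \<omega>) \<in> Q"
  using AE_uniform_in_unit[OF V_measurable(1) V_uniform(1)] AE_uniform_in_unit[OF V_measurable(2) V_uniform(2)]
  by eventually_elim (simp add: Q_def)

lemma AE_U: "AE \<omega> in N. (U1 \<omega>, U2 \<omega>) \<in> Q"
  using AE_uniform_in_unit[OF U_measurable(1) U_uniform(1)] AE_uniform_in_unit[OF U_measurable(2) U_uniform(2)]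
  by eventually_elim (simp add: Q_def)

lemma Q_borel: "Q \<in> sets borel" and Q_subset: "Q \<subseteq> {0..1} \<times> {0..1}"
  unfolding Q_def by (auto intro!: borel_open open_Times)

lemma bounded_on_Q:
  fixes F :: "real \<times> real \<Rightarrow> real"
  assumes "continuous_on UNIV F"
  obtains C where "\<And>z. z \<in> Q \<Longrightarrow> \<bar>F z\<bar> \<le> C"
proof -
  have "bounded (F ` ({0..1} \<times> {0..1}))"
    using assms by (intro compact_imp_bounded compact_continuous_image compact_Times)
      (auto intro: continuous_on_subset)
  then obtain C where "\<forall>z\<in>{0..1} \<times> {0..1}. \<bar>F z\<bar> \<le> C" unfolding bounded_iff by auto
  then show ?thesis using that Q_subset by blast
qed

lemma
  fixes F :: "real \<times> real \<Rightarrow> real"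
  assumes "continuous_on UNIV F"
  shows integrable_V: "integrable M (\<lambda>\<omega>. F (V1 \<omega>, V2 \<omega>))"
    and integrable_U: "integrable N (\<lambda>\<omega>. F (U1 \<omega>, U2 \<omega>))"
proof -
  have F: "F \<in> borel_measurable borel" using assms by (rule borel_measurable_continuous_onI)
  obtain C where C: "\<And>z. z \<in> Q \<Longrightarrow> \<bar>F z\<bar> \<le> C" using bounded_on_Q[OF assms] by blast
  show "integrable M (\<lambda>\<omega>. F (V1 \<omega>, V2 \<omega>))"
  proof (rule M.integrable_const_bound)
    show "AE \<omega> in M. norm (F (V1 \<omega>, V2 \<omega>)) \<le> C"
      using AE_V by eventually_elim (use C in auto)
    show "(\<lambda>\<omega>. F (V1 \<omega>, V2 \<omega>)) \<in> borel_measurable M"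
      by (rule measurable_compose[OF borel_measurable_Pair F]) simp_all
  qed
  show "integrable N (\<lambda>\<omega>. F (U1 \<omega>, U2 \<omega>))"
  proof (rule N.integrable_const_bound)
    show "AE \<omega> in N. norm (F (U1 \<omega>, U2 \<omega>)) \<le> C"
      using AE_U by eventually_elim (use C in auto)
    show "(\<lambda>\<omega>. F (U1 \<omega>, U2 \<omega>)) \<in> borel_measurable N"
      by (rule measurable_compose[OF borel_measurable_Pair F]) simp_all
  qed
qed

lemma set_integrable_c: "set_integrable lborel Q c"
proof -
  have "integrable lborel (\<lambda>z. c z * indicator Q z) \<longleftrightarrow> integrable M (\<lambda>\<omega>. indicator Q (V1 \<omega>, V2 \<omega>) :: real)"
    using Q_borel c_nonneg by (intro distributed_integrable[OF c_density]) auto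
  moreover have "integrable M (\<lambda>\<omega>. indicator Q (V1 \<omega>, V2 \<omega>) :: real)"
    using Q_borel by (intro M.integrable_const_bound[of _ 1]) (auto simp: indicator_def)
  ultimately show ?thesis by (simp add: set_integrable_def mult.commute)
qed

text \<open>The indicator of \<open>Q\<close> is carried through the change of variables and then
  dropped, since \<open>(V1, V2)\<close> lies in \<open>Q\<close> almost surely.\<close>

lemma expectation_V:
  fixes F :: "real \<times> real \<Rightarrow> real"
  assumes "F \<in> borel_measurable borel"
  shows "(\<integral>\<omega>. F (V1 \<omega>, V2 \<omega>) \<partial>M) = (LINT z:Q|lborel. F z * c z)"
proof -
  have "(LINT z:Q|lborel. F z * c z) = (\<integral>z. c z * (indicator Q z * F z) \<partial>lborel)"
    by (simp add: set_lebesgue_integral_def mult_ac)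
  also have "\<dots> = (\<integral>\<omega>. indicator Q (V1 \<omega>, V2 \<omega>) * F (V1 \<omega>, V2 \<omega>) \<partial>M)"
    using assms Q_borel c_nonneg by (intro distributed_integral[OF c_density]) auto
  also have "\<dots> = (\<integral>\<omega>. F (V1 \<omega>, V2 \<omega>) \<partial>M)"
  proof (rule integral_cong_AE)
    have F: "(\<lambda>\<omega>. F (V1 \<omega>, V2 \<omega>)) \<in> borel_measurable M"
      by (rule measurable_compose[OF borel_measurable_Pair assms]) simp_all
    then show "(\<lambda>\<omega>. F (V1 \<omega>, V2 \<omega>)) \<in> borel_measurable M" .
    have "(\<lambda>\<omega>. indicator Q (V1 \<omega>, V2 \<omega>) :: real) \<in> borel_measurable M"
      using Q_borel by (intro measurable_compose[OF borel_measurable_Pair borel_measurable_indicator]) simp_all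
    with F show "(\<lambda>\<omega>. indicator Q (V1 \<omega>, V2 \<omega>) * F (V1 \<omega>, V2 \<omega>)) \<in> borel_measurable M"
      by measurable
    show "AE \<omega> in M. indicator Q (V1 \<omega>, V2 \<omega>) * F (V1 \<omega>, V2 \<omega>) = F (V1 \<omega>, V2 \<omega>)"
      using AE_V by eventually_elim simp
  qed
  finally show ?thesis by simp
qed

text \<open>
  Here \<open>H (x, \<cdot>)\<close> is the primitive, vanishing at 0 and 1, of \<open>p (x, \<cdot>)\<close> centred by its mean.
\<close>

definition vertical_potential :: "(real \<times> real \<Rightarrow> real) \<Rightarrow> (real \<times> real \<Rightarrow> real) \<Rightarrow> bool"
  where "vertical_potential p H \<longleftrightarrow> continuous_on UNIV p \<and> continuous_on UNIV H
    \<and> (\<exists>m. \<forall>x y. ((\<lambda>y. H (x, y)) has_real_derivative p (x, y) - m x) (at y))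
    \<and> (\<forall>x. H (x, 0) = 0 \<and> H (x, 1) = 0)
    \<and> (\<integral>\<omega>. p (V1 \<omega>, V2 \<omega>) \<partial>M) - (\<integral>\<omega>. p (U1 \<omega>, U2 \<omega>) \<partial>N) = - (LINT z:Q|lborel. H z * snd (grad_c z))"

lemma set_integrable_mult_gradient:
  fixes H :: "real \<times> real \<Rightarrow> real"
  assumes "continuous_on UNIV H"
  shows "set_integrable lborel Q (\<lambda>z. H z * snd (grad_c z))"
proof -
  obtain C where C: "\<And>z. z \<in> Q \<Longrightarrow> \<bar>H z\<bar> \<le> C" using bounded_on_Q[OF assms] by blast
  have "set_integrable lborel Q (\<lambda>z. snd (grad_c z))"
    using integrable_bounded_linear[OF bounded_linear_snd gradient_integrable[unfolded set_integrable_def]]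
    by (simp add: set_integrable_def)
  from set_integrable_bounded_mult[OF this borel_measurable_continuous_onI[OF assms] Q_borel C]
  show ?thesis by simp
qed

text \<open>All clauses are linear in the pair of functions, given that the integrals involved
  converge; the means \<open>m\<close> and \<open>m'\<close> add up.\<close>

lemma vertical_potential_add:
  assumes "vertical_potential p H" "vertical_potential p' H'"
  shows "vertical_potential (\<lambda>z. p z + p' z) (\<lambda>z. H z + H' z)"
proof -
  have p: "continuous_on UNIV p" "continuous_on UNIV p'" and H: "continuous_on UNIV H" "continuous_on UNIV H'"
    using assms by (auto simp: vertical_potential_def)
  obtain m m' where "\<And>x y. ((\<lambda>y. H (x, y)) has_real_derivative p (x, y) - m x) (at y)"
    "\<And>x y. ((\<lambda>y. H' (x, y)) has_real_derivative p' (x, y) - m' x) (at y)"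
    using assms by (auto simp: vertical_potential_def)
  then have "((\<lambda>y. H (x, y) + H' (x, y)) has_real_derivative p (x, y) + p' (x, y) - (m x + m' x)) (at y)" for x y
    by (auto intro!: derivative_eq_intros)
  then have "\<exists>m. \<forall>x y. ((\<lambda>y. H (x, y) + H' (x, y)) has_real_derivative p (x, y) + p' (x, y) - m x) (at y)"
    by (intro exI[of _ "\<lambda>x. m x + m' x"]) auto
  moreover have "(LINT z:Q|lborel. (H z + H' z) * snd (grad_c z))
      = (LINT z:Q|lborel. H z * snd (grad_c z)) + (LINT z:Q|lborel. H' z * snd (grad_c z))"
    using set_integral_add(2)[OF set_integrable_mult_gradient[OF H(1)] set_integrable_mult_gradient[OF H(2)]]
    by (simp add: distrib_right)
  ultimately show ?thesis
    using assms p H integrable_V[OF p(1)] integrable_V[OF p(2)] integrable_U[OF p(1)] integrable_U[OF p(2)]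
    unfolding vertical_potential_def by (auto intro!: continuous_intros)
qed

text \<open>With \<open>k\<close> the mean of \<open>r\<close> over [0, 1], independence gives E
  p(U1, U2) = k E U1^i, which equals k E V1^i because \<open>U1\<close> and \<open>V1\<close> have
  the same law. The difference of expectations is thus that of x^i (r(y) - k) at
  \<open>(V1, V2)\<close>, an exact \<open>y\<close>-derivative to be integrated by parts against
  \<open>c\<close>.\<close>

lemma vertical_potential_monomial: "\<exists>H. vertical_potential (\<lambda>z. fst z ^ i * poly r (snd z)) H"
proof -
  obtain R where R: "pderiv R = r" by (rule poly_antiderivative)
  define k where "k = poly R 1 - poly R 0"
  \<comment> \<open>The line \<open>[:poly R 0, k:]\<close> is the chord of \<open>R\<close> over
    [0, 1]; subtracting it makes \<open>B\<close> vanish at both ends and its derivative equal to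
    \<open>r - k\<close>.\<close>
  define B where "B = R - [:poly R 0, k:]"
  have "poly B 0 = 0" "poly B 1 = 0" by (auto simp: B_def k_def)
  then obtain S where S: "B = [:0, 1, -1:] * S" by (rule poly_vanishing_at_0_1)
  have B: "poly B y = y * (1 - y) * poly S y" for y
    unfolding S by (simp add: algebra_simps)
  have dB: "poly (pderiv B) y = poly r y - k" for y
    by (simp add: B_def pderiv_diff R pderiv_pCons)
  have dB': "poly (pderiv B) y = (1 - 2 * y) * poly S y + y * (1 - y) * poly (pderiv S) y" for y
  proof -
    have "pderiv [:0, 1, -1:] = [:1, -2::real:]" by (simp add: pderiv_pCons)
    then show ?thesis
      unfolding S by (simp only: pderiv_mult poly_add poly_mult) (simp add: algebra_simps)
  qed
  define H where "H z = fst z ^ i * poly B (snd z)" for z :: "real \<times> real"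
  have cp: "continuous_on UNIV (\<lambda>z::real\<times>real. fst z ^ i * poly r (snd z))"
    by (intro continuous_intros)
  have cx: "continuous_on UNIV (\<lambda>z::real\<times>real. fst z ^ i * k)"
    by (intro continuous_intros)
  have cH: "continuous_on UNIV H"
    unfolding H_def by (intro continuous_intros)
  have "(\<integral>\<omega>. V1 \<omega> ^ i \<partial>M) = (\<integral>x. x ^ i \<partial>distr M lborel V1)"
    by (subst integral_distr) auto
  also have "\<dots> = (\<integral>x. x ^ i \<partial>distr N lborel U1)"
    by (simp add: V_uniform U_uniform)
  also have "\<dots> = (\<integral>\<omega>. U1 \<omega> ^ i \<partial>N)"
    by (subst integral_distr) auto
  finally have moments: "(\<integral>\<omega>. V1 \<omega> ^ i \<partial>M) = (\<integral>\<omega>. U1 \<omega> ^ i \<partial>N)" .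
  have r: "poly r \<in> borel_measurable borel"
    by (intro borel_measurable_continuous_onI continuous_at_imp_continuous_on ballI poly_isCont)
  have "(\<integral>\<omega>. poly r (U2 \<omega>) \<partial>N) = (\<integral>x. poly r x \<partial>distr N lborel U2)"
    using r by (subst integral_distr) auto
  also have "\<dots> = (\<integral>x. indicator {0..1} x *\<^sub>R poly r x \<partial>lborel)"
  proof -
    have "distr N lborel U2 = density lborel (\<lambda>x. ennreal (indicator {0..1} x))"
      unfolding U_uniform uniform_measure_def
      by (intro arg_cong[where f = "density lborel"] ext) (simp add: indicator_def divide_ennreal_def)
    then show ?thesis using r by (simp add: integral_density)
  qed
  also have "\<dots> = k"
    unfolding k_def
    by (rule integral_FTC_atLeastAtMost)
      (auto intro!: continuous_intros has_field_derivative_at_within poly_DERIV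
        simp: has_real_derivative_iff_has_vector_derivative[symmetric] R[symmetric])
  finally have k: "(\<integral>\<omega>. poly r (U2 \<omega>) \<partial>N) = k" .
  have "N.indep_var borel (\<lambda>\<omega>. U1 \<omega> ^ i) borel (\<lambda>\<omega>. poly r (U2 \<omega>))"
    using N.indep_var_compose[OF U_indep _ r, of "\<lambda>x. x ^ i" borel]
    by (simp add: comp_def)
  moreover have "integrable N (\<lambda>\<omega>. U1 \<omega> ^ i)" "integrable N (\<lambda>\<omega>. poly r (U2 \<omega>))"
    using integrable_U[of "\<lambda>z. fst z ^ i", OF continuous_on_power[OF continuous_on_fst[OF continuous_on_id]]]
      integrable_U[of "\<lambda>z. poly r (snd z)", OF continuous_on_poly[OF continuous_on_snd[OF continuous_on_id]]]
    by simp_all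
  ultimately have "(\<integral>\<omega>. U1 \<omega> ^ i * poly r (U2 \<omega>) \<partial>N)
      = (\<integral>\<omega>. U1 \<omega> ^ i \<partial>N) * (\<integral>\<omega>. poly r (U2 \<omega>) \<partial>N)"
    by (rule N.indep_var_lebesgue_integral)
  also have "\<dots> = (\<integral>\<omega>. V1 \<omega> ^ i * k \<partial>M)"
    by (simp add: k moments)
  finally have "(\<integral>\<omega>. V1 \<omega> ^ i * poly r (V2 \<omega>) \<partial>M) - (\<integral>\<omega>. U1 \<omega> ^ i * poly r (U2 \<omega>) \<partial>N)
      = (\<integral>\<omega>. V1 \<omega> ^ i * poly r (V2 \<omega>) - V1 \<omega> ^ i * k \<partial>M)"
    using Bochner_Integration.integral_diff[OF integrable_V[OF cp] integrable_V[OF cx]]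
    by (simp only: fst_conv snd_conv)
  also have "\<dots> = (\<integral>\<omega>. V1 \<omega> ^ i * poly (pderiv B) (V2 \<omega>) \<partial>M)"
    by (simp only: dB right_diff_distrib)
  also have "\<dots> = (LINT z:Q|lborel. fst z ^ i * poly (pderiv B) (snd z) * c z)"
  proof -
    have "(\<lambda>z::real\<times>real. fst z ^ i * poly (pderiv B) (snd z)) \<in> borel_measurable borel"
      by (intro borel_measurable_continuous_onI continuous_intros)
    from expectation_V[OF this] show ?thesis by (simp only: fst_conv snd_conv)
  qed
  also have "\<dots> = - (LINT z:Q|lborel. H z * snd (grad_c z))"
    unfolding dB' H_def B Q_def
  proof (rule weak_gradient_vertical_integration_by_parts[where a' = "\<lambda>x. real i * x ^ (i - 1)"])
    \<comment> \<open>For \<open>i = 0\<close> the exponent \<open>i - 1\<close> truncates to 0,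
      which is harmless because of the factor \<open>real i\<close>.\<close>
    show "((\<lambda>x. x ^ i) has_real_derivative real i * x ^ (i - 1)) (at x)" for x
      using DERIV_pow[of i x UNIV] by simp
    show "continuous_on UNIV (\<lambda>x. real i * x ^ (i - 1))" "continuous_on UNIV (poly (pderiv S))"
      by (intro continuous_intros continuous_at_imp_continuous_on ballI poly_isCont)+
  qed (use weak_gradient set_integrable_c gradient_integrable in \<open>simp_all add: Q_def poly_DERIV\<close>)
  finally have diff: "(\<integral>\<omega>. V1 \<omega> ^ i * poly r (V2 \<omega>) \<partial>M) - (\<integral>\<omega>. U1 \<omega> ^ i * poly r (U2 \<omega>) \<partial>N)
      = - (LINT z:Q|lborel. H z * snd (grad_c z))" .
  have "((\<lambda>y. H (x, y)) has_real_derivative x ^ i * poly r y - x ^ i * k) (at y)" for x y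
    unfolding H_def using DERIV_cmult[OF poly_DERIV[of B y], of "x ^ i"] by (simp add: dB right_diff_distrib)
  then have "\<exists>m. \<forall>x y. ((\<lambda>y. H (x, y)) has_real_derivative x ^ i * poly r y - m x) (at y)"
    by (intro exI[of _ "\<lambda>x. x ^ i * k"]) auto
  moreover have "H (x, 0) = 0 \<and> H (x, 1) = 0" for x
    by (simp add: H_def B)
  ultimately have "vertical_potential (\<lambda>z. fst z ^ i * poly r (snd z)) H"
    unfolding vertical_potential_def fst_conv snd_conv using cp cH diff by blast
  then show ?thesis by blast
qed

text \<open>Induction on the outer polynomial, with the power of x generalised: x^i (r(y) + x P)
  splits into a monomial term and x^(i+1) P.\<close>

lemma vertical_potential_bipoly: "\<exists>H. vertical_potential (bipoly P) H"
proof -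
  have "\<exists>H. vertical_potential (\<lambda>z. fst z ^ i * bipoly P z) H" for i
  proof (induction P arbitrary: i)
    case 0
    show ?case using vertical_potential_monomial[of i 0] by (simp add: bipoly_def)
  next
    case (pCons r P)
    obtain H H' where "vertical_potential (\<lambda>z. fst z ^ i * poly r (snd z)) H"
      "vertical_potential (\<lambda>z. fst z ^ Suc i * bipoly P z) H'"
      using vertical_potential_monomial pCons.IH by meson
    from vertical_potential_add[OF this] show ?case
      by (auto simp: bipoly_def algebra_simps)
  qed
  from this[of 0] show ?thesis by simp
qed

lemma expectation_difference_bound:
  assumes h: "1-lipschitz_on UNIV h"
  shows "\<bar>(\<integral>\<omega>. h (V1 \<omega>, V2 \<omega>) \<partial>M) - (\<integral>\<omega>. h (U1 \<omega>, U2 \<omega>) \<partial>N)\<bar>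
    \<le> 1 / 8 * (LINT z:Q|lborel. norm (grad_c z))"
proof -
  define G where "G = (LINT z:Q|lborel. norm (grad_c z))"
  have ch: "continuous_on S h" for S
    using lipschitz_on_continuous_on[OF h] by (rule continuous_on_subset) simp
  have G0: "0 \<le> G" unfolding G_def set_lebesgue_integral_def by (intro Bochner_Integration.integral_nonneg) simp
  \<comment> \<open>The error \<open>e * (2 + G)\<close> consists of \<open>e\<close> for each of
    the two expectations in which \<open>h\<close> is replaced by a polynomial, and
    \<open>e * G\<close> from the weaker bound \<open>1 / 8 + e\<close> on the potential.\<close>
  have approx: "\<bar>(\<integral>\<omega>. h (V1 \<omega>, V2 \<omega>) \<partial>M) - (\<integral>\<omega>. h (U1 \<omega>, U2 \<omega>) \<partial>N)\<bar> \<le> 1 / 8 * G + e * (2 + G)"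
    if e: "0 < e" for e
  proof -
    obtain P where P: "\<And>z. z \<in> {0..1} \<times> {0..1} \<Longrightarrow> \<bar>h z - bipoly P z\<bar> < e"
      using bipoly_dense[OF ch, of "{0..1} \<times> {0..1}" e] e by (auto simp: compact_Times)
    obtain H where "vertical_potential (bipoly P) H" using vertical_potential_bipoly by blast
    then obtain m where cH: "continuous_on UNIV H"
      and dH: "\<And>x y. ((\<lambda>y. H (x, y)) has_real_derivative bipoly P (x, y) - m x) (at y)"
      and H0: "\<And>x. H (x, 0) = 0" "\<And>x. H (x, 1) = 0"
      and eq: "(\<integral>\<omega>. bipoly P (V1 \<omega>, V2 \<omega>) \<partial>M) - (\<integral>\<omega>. bipoly P (U1 \<omega>, U2 \<omega>) \<partial>N)
        = - (LINT z:Q|lborel. H z * snd (grad_c z))"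
      by (auto simp: vertical_potential_def)
    have bH: "\<bar>H z\<bar> \<le> 1 / 8 + e" if z: "z \<in> Q" for z
    proof -
      obtain x y where xy: "z = (x, y)" "x \<in> {0..1}" "y \<in> {0..1}" using z by (auto simp: Q_def)
      \<comment> \<open>Comparing the polynomial with \<open>h\<close> at both \<open>(x, s)\<close>
        and \<open>(x, y)\<close> costs \<open>e\<close> each, hence the slack \<open>2 * e\<close>.
        The mean \<open>m x\<close> does not depend on the second coordinate and cancels.\<close>
      have "\<bar>H (x, y)\<bar> \<le> 1 / 8 + (2 * e) / 2"
      proof (rule pinned_bound[where u = "\<lambda>y. H (x, y)", OF dH H0 xy(3)])
        fix s :: real assume s: "s \<in> {0..1}"
        have "\<bar>h (x, s) - h (x, y)\<bar> \<le> \<bar>s - y\<bar>"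
          using lipschitz_onD[OF h, of "(x, s)" "(x, y)"] by (simp add: dist_Pair_Pair dist_real_def)
        moreover have "\<bar>h (x, s) - bipoly P (x, s)\<bar> < e" "\<bar>h (x, y) - bipoly P (x, y)\<bar> < e"
          using P xy s by auto
        ultimately show "\<bar>bipoly P (x, s) - m x - (bipoly P (x, y) - m x)\<bar> \<le> \<bar>s - y\<bar> + 2 * e"
          by linarith
      qed
      then show ?thesis by (simp add: xy)
    qed
    have "\<bar>LINT z:Q|lborel. H z * snd (grad_c z)\<bar> \<le> (LINT z:Q|lborel. (1 / 8 + e) * norm (grad_c z))"
      unfolding set_lebesgue_integral_def
    proof (rule integral_abs_bound_integral)
      show "integrable lborel (\<lambda>z. indicator Q z *\<^sub>R (H z * snd (grad_c z)))"
        using set_integrable_mult_gradient[OF cH] by (simp add: set_integrable_def)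
      have "integrable lborel (\<lambda>z. (1 / 8 + e) * norm (indicator Q z *\<^sub>R grad_c z))"
        using gradient_integrable unfolding set_integrable_def by (intro integrable_mult_right integrable_norm)
      then show "integrable lborel (\<lambda>z. indicator Q z *\<^sub>R ((1 / 8 + e) * norm (grad_c z)))"
        by (simp add: mult.left_commute)
      show "\<bar>indicator Q z *\<^sub>R (H z * snd (grad_c z))\<bar> \<le> indicator Q z *\<^sub>R ((1 / 8 + e) * norm (grad_c z))" for z
        using bH[of z] norm_snd_le[of "snd (grad_c z)" "fst (grad_c z)"] e
        by (auto simp: indicator_def abs_mult intro!: mult_mono)
    qed
    also have "\<dots> = (1 / 8 + e) * G" by (simp add: G_def)
    finally have 1: "\<bar>(\<integral>\<omega>. bipoly P (V1 \<omega>, V2 \<omega>) \<partial>M) - (\<integral>\<omega>. bipoly P (U1 \<omega>, U2 \<omega>) \<partial>N)\<bar> \<le> (1 / 8 + e) * G"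
      unfolding eq by simp
    have cd: "continuous_on UNIV (\<lambda>z. \<bar>h z - bipoly P z\<bar>)"
      by (intro continuous_intros ch continuous_on_bipoly)
    have PQ: "\<bar>h z - bipoly P z\<bar> \<le> e" if "z \<in> Q" for z
      using P[of z] that Q_subset by auto
    have tri: "\<bar>\<integral>\<omega>. h (V1 \<omega>, V2 \<omega>) - bipoly P (V1 \<omega>, V2 \<omega>) \<partial>M\<bar> \<le> (\<integral>\<omega>. \<bar>h (V1 \<omega>, V2 \<omega>) - bipoly P (V1 \<omega>, V2 \<omega>)\<bar> \<partial>M)"
      by (rule integral_abs_bound)
    have "AE \<omega> in M. \<bar>h (V1 \<omega>, V2 \<omega>) - bipoly P (V1 \<omega>, V2 \<omega>)\<bar> \<le> e"
      using AE_V by eventually_elim (rule PQ)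
    then have le: "(\<integral>\<omega>. \<bar>h (V1 \<omega>, V2 \<omega>) - bipoly P (V1 \<omega>, V2 \<omega>)\<bar> \<partial>M) \<le> e"
      by (intro M.integral_le_const integrable_V[OF cd])
    have 2: "\<bar>(\<integral>\<omega>. h (V1 \<omega>, V2 \<omega>) \<partial>M) - (\<integral>\<omega>. bipoly P (V1 \<omega>, V2 \<omega>) \<partial>M)\<bar> \<le> e"
      using order_trans[OF tri le] integrable_V[OF ch] integrable_V[OF continuous_on_bipoly] by simp
    have tri: "\<bar>\<integral>\<omega>. h (U1 \<omega>, U2 \<omega>) - bipoly P (U1 \<omega>, U2 \<omega>) \<partial>N\<bar> \<le> (\<integral>\<omega>. \<bar>h (U1 \<omega>, U2 \<omega>) - bipoly P (U1 \<omega>, U2 \<omega>)\<bar> \<partial>N)"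
      by (rule integral_abs_bound)
    have "AE \<omega> in N. \<bar>h (U1 \<omega>, U2 \<omega>) - bipoly P (U1 \<omega>, U2 \<omega>)\<bar> \<le> e"
      using AE_U by eventually_elim (rule PQ)
    then have le: "(\<integral>\<omega>. \<bar>h (U1 \<omega>, U2 \<omega>) - bipoly P (U1 \<omega>, U2 \<omega>)\<bar> \<partial>N) \<le> e"
      by (intro N.integral_le_const integrable_U[OF cd])
    have 3: "\<bar>(\<integral>\<omega>. h (U1 \<omega>, U2 \<omega>) \<partial>N) - (\<integral>\<omega>. bipoly P (U1 \<omega>, U2 \<omega>) \<partial>N)\<bar> \<le> e"
      using order_trans[OF tri le] integrable_U[OF ch] integrable_U[OF continuous_on_bipoly] by simp
    show ?thesis using 1 2 3 by (simp add: algebra_simps)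
  qed
  show ?thesis
    unfolding G_def[symmetric]
  proof (rule field_le_epsilon)
    fix e :: real assume "0 < e"
    then show "\<bar>(\<integral>\<omega>. h (V1 \<omega>, V2 \<omega>) \<partial>M) - (\<integral>\<omega>. h (U1 \<omega>, U2 \<omega>) \<partial>N)\<bar> \<le> 1 / 8 * G + e"
      using approx[of "e / (2 + G)"] G0 by simp
  qed
qed

end

section \<open>Cauchy-Schwarz on the unit square and the supremum over Lipschitz functions\<close>

theorem corollary4p3:
  fixes M :: "'a measure" and V1 V2 :: "'a \<Rightarrow> real"
    and N :: "'b measure" and U1 U2 :: "'b \<Rightarrow> real"
    and c :: "real \<times> real \<Rightarrow> real"
    and grad_c :: "real \<times> real \<Rightarrow> real \<times> real"
    and \<Omega> :: "(real \<times> real) set"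
  assumes "prob_space M"
    and "V1 \<in> borel_measurable M" and "V2 \<in> borel_measurable M"
    and "distr M lborel V1 = uniform_measure lborel {0..1}"
    and "distr M lborel V2 = uniform_measure lborel {0..1}"
    and "\<And>x. 0 \<le> c x"
    and "distributed M lborel (\<lambda>\<omega>. (V1 \<omega>, V2 \<omega>)) (\<lambda>x. ennreal (c x))"
    and "C1_density c \<Omega> grad_c"
    and "has_weak_gradient_on c grad_c ({0<..<1} \<times> {0<..<1})"
    and "prob_space N"
    and "U1 \<in> borel_measurable N" and "U2 \<in> borel_measurable N"
    and "distr N lborel U1 = uniform_measure lborel {0..1}"
    and "distr N lborel U2 = uniform_measure lborel {0..1}"
    and "prob_space.indep_var N borel U1 borel U2"
  shows "wasserstein_dist M (\<lambda>\<omega>. (V1 \<omega>, V2 \<omega>)) N (\<lambda>\<omega>. (U1 \<omega>, U2 \<omega>))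
    \<le> ennreal (2 / pi\<^sup>2) *
       ennreal_sqrt (\<integral>\<^sup>+x\<in>{0..1} \<times> {0..1}. ennreal ((norm (grad_c x))\<^sup>2) \<partial>lborel)"
proof -
  define Q :: "(real \<times> real) set" where "Q = {0<..<1} \<times> {0<..<1}"
  define I where "I = (\<integral>\<^sup>+x\<in>{0..1} \<times> {0..1}. ennreal ((norm (grad_c x))\<^sup>2) \<partial>lborel)"
  show ?thesis
  proof (cases "I = \<top>")
    \<comment> \<open>The constant \<open>2 / pi\<^sup>2\<close> is positive, so the right-hand side
      is infinite.\<close>
    case True
    then show ?thesis
      unfolding I_def[symmetric] by (simp add: ennreal_sqrt_def ennreal_mult_top)
  next
    case False
    have Q: "open Q" "Q \<in> sets borel" "Q \<subseteq> {0..1} \<times> {0..1}"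
      unfolding Q_def by (auto intro!: borel_open open_Times)
    have meas: "set_borel_measurable lborel Q grad_c"
    proof (rule set_borel_measurable_open_exhaustion[OF Q(1)])
      fix K assume "compact K" "K \<subseteq> Q"
      then have "set_integrable lborel K grad_c"
        using assms(9) by (auto simp: has_weak_gradient_on_def Q_def)
      then show "set_borel_measurable lborel K grad_c"
        by (auto simp: set_integrable_def set_borel_measurable_def)
    qed
    \<comment> \<open>Truncation to the open square yields a measurable function; since
      \<open>Q\<close> lies in the closed square, its squared norm integrates to at most
      \<open>I\<close>.\<close>
    define G where "G x = indicator Q x *\<^sub>R grad_c x" for x
    have G: "G \<in> borel_measurable lborel"
      using meas by (simp add: G_def[abs_def] set_borel_measurable_def)
    have "Q \<subseteq> cbox (0, 0) (1, 1)"
      using Q by (simp add: cbox_Pair_eq)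
    then have "emeasure lborel Q \<le> emeasure lborel (cbox (0, 0) (1, 1) :: (real \<times> real) set)"
      by (intro emeasure_mono) auto
    then have Q1: "emeasure lborel Q \<le> 1"
      by (simp add: emeasure_lborel_cbox_eq Basis_prod_def inner_prod_def)
    \<comment> \<open>The indicator of \<open>Q\<close>, redundant in front of \<open>G\<close>,
      serves as the second function in Cauchy-Schwarz; its square integrates to at most 1. Working
      with nonnegative integrals avoids presupposing that \<open>G\<close> is integrable.\<close>
    have "(\<integral>\<^sup>+x. ennreal (norm (G x)) \<partial>lborel)\<^sup>2
        = (\<integral>\<^sup>+x. ennreal (norm (G x)) * indicator Q x \<partial>lborel)\<^sup>2"
      by (intro arg_cong[where f = "\<lambda>t. t\<^sup>2"] nn_integral_cong) (auto simp: G_def indicator_def)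
    also have "\<dots> \<le> (\<integral>\<^sup>+x. (ennreal (norm (G x)))\<^sup>2 \<partial>lborel) * (\<integral>\<^sup>+x. (indicator Q x)\<^sup>2 \<partial>lborel)"
      using G Q(2) by (intro Cauchy_Schwarz_nn_integral) auto
    also have "\<dots> \<le> I * 1"
    proof (rule mult_mono)
      show "(\<integral>\<^sup>+x. (ennreal (norm (G x)))\<^sup>2 \<partial>lborel) \<le> I"
        unfolding I_def using Q(3)
        by (intro nn_integral_mono) (auto simp: G_def indicator_def ennreal_power)
      have "(\<integral>\<^sup>+x. (indicator Q x)\<^sup>2 \<partial>lborel) = (\<integral>\<^sup>+x. indicator Q x \<partial>lborel)"
        by (rule nn_integral_cong) (simp add: indicator_def)
      with Q1 Q(2) show "(\<integral>\<^sup>+x. (indicator Q x)\<^sup>2 \<partial>lborel) \<le> 1" by simp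
    qed auto
    finally have L1: "(\<integral>\<^sup>+x. ennreal (norm (G x)) \<partial>lborel)\<^sup>2 \<le> I" by simp
    have "(\<integral>\<^sup>+x. ennreal (norm (G x)) \<partial>lborel) < \<infinity>"
      using L1 False by (auto simp: less_top[symmetric] top_unique power2_eq_square)
    then have Gint: "integrable lborel G"
      using G by (intro integrableI_bounded) auto
    then have gint: "set_integrable lborel Q grad_c"
      by (simp add: set_integrable_def G_def[abs_def])
    define L where "L = (LINT z:Q|lborel. norm (grad_c z))"
    have L: "L = (\<integral>x. norm (G x) \<partial>lborel)"
      unfolding L_def set_lebesgue_integral_def
      by (intro Bochner_Integration.integral_cong) (auto simp: G_def indicator_def)
    have L0: "0 \<le> L" unfolding L by simp
    have "(\<integral>\<^sup>+x. ennreal (norm (G x)) \<partial>lborel) = ennreal L"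
      unfolding L using Gint by (intro nn_integral_eq_integral) auto
    with L1 have "ennreal (L\<^sup>2) \<le> I" using L0 by (simp add: ennreal_power)
    then have "L\<^sup>2 \<le> enn2real I"
      using False by (cases I) (auto simp: ennreal_le_iff)
    then have LI: "L \<le> sqrt (enn2real I)"
      by (rule real_le_rsqrt)
    interpret copula_density M N V1 V2 U1 U2 c grad_c Q
      unfolding copula_density_def copula_density_axioms_def Q_def
      by (intro conjI assms allI gint[unfolded Q_def])
    \<comment> \<open>This amounts to \<open>pi\<^sup>2 \<le> 16\<close>, so the crude bound of
      \<open>pi\<close> by 4 is enough.\<close>
    have pi: "1 / 8 \<le> 2 / pi\<^sup>2"
    proof -
      have "pi\<^sup>2 \<le> 4\<^sup>2" using pi_less_4 pi_ge_zero by (intro power_mono) auto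
      then show ?thesis by (simp add: field_simps)
    qed
    have "ennreal \<bar>(\<integral>\<omega>. h (V1 \<omega>, V2 \<omega>) \<partial>M) - (\<integral>\<omega>. h (U1 \<omega>, U2 \<omega>) \<partial>N)\<bar>
        \<le> ennreal (2 / pi\<^sup>2) * ennreal_sqrt I" if h: "1-lipschitz_on UNIV h" for h
    proof -
      have "\<bar>(\<integral>\<omega>. h (V1 \<omega>, V2 \<omega>) \<partial>M) - (\<integral>\<omega>. h (U1 \<omega>, U2 \<omega>) \<partial>N)\<bar> \<le> 1 / 8 * L"
        unfolding L_def by (rule expectation_difference_bound[OF h])
      also have "\<dots> \<le> 2 / pi\<^sup>2 * sqrt (enn2real I)"
        using pi LI L0 by (intro mult_mono) auto
      finally show ?thesis
        using False by (simp add: ennreal_sqrt_def ennreal_mult[symmetric] ennreal_leI)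
    qed
    then show ?thesis
      unfolding wasserstein_dist_def I_def[symmetric] by (intro SUP_least) auto
  qed
qed

end
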